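(* Let $X=\{0,1\}^{\mathbb Z}$ be the full 2-shift, let $D=b_1b_2\cdots b_k$ be a binary block of length $k\ge1$, and let $\phi:X\to Y=\phi(X)\subset\{0,1\}^{\mathbb Z}$ be the factor code with an unambiguous symbol determined by $D$. Let $\mathcal F$ be the standard forbidden set of the gap shift $Y$ and let $\overline{\mathcal F}$ be the bitwise complement of $\mathcal F$. Then the following are equivalent: (1) at least one of the symbols $0,1$ occurs at most once in $D$; (2) $\phi|_{X_{\mathcal F}}$ or $\phi|_{X_{\overline{\mathcal F}}}$ is one-to-one and onto $Y$; (3) $\phi|_{X_{\mathcal F}}$ or $\phi|_{X_{\overline{\mathcal F}}}$ is finite-to-one and onto $Y$; (4) $\phi|_{X_{\mathcal F}}$ or $\phi|_{X_{\overline{\mathcal F}}}$ is onto $Y$.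
   Context: Factor code with an unambiguous symbol: given the block $D=b_1\cdots b_k$, let $\Phi:\{0,1\}^k\to\{0,1\}$ be defined by $\Phi(w)=1$ if $w=D$ and $\Phi(w)=0$ otherwise; $\phi(x)_i=\Phi(x_{i-s}\cdots x_{i+t})$ for fixed integers $s,t$ with $s+t+1=k$, and $Y:=\phi(X)$. For $S\subset\mathbb Z_{\ge0}$, the $S$-gap shift $X(S)\subset\{0,1\}^{\mathbb Z}$ is the shift space whose points are concatenations of blocks $0^s1$ with $s\in S$ (the number of $0$'s between consecutive $1$'s lies in $S$), where infinite runs of $0$'s are allowed exactly when $S$ is infinite. In the present setting $Y$ is an $S$-gap shift with $S$ cofinite in $\mathbb Z_{\ge0}$; its standard forbidden set is $\mathcal F=\{10^m1: m\in\mathbb Z_{\ge0}\setminus S\}$. The bitwise complement $\overline{\mathcal F}$ is the set of blocks obtained from those in $\mathcal F$ by interchanging $0$ and $1$. For a set $\mathcal G$ of binary blocks, $X_{\mathcal G}$ is the set of $x\in\{0,1\}^{\mathbb Z}$ containing no block of $\mathcal G$. A map is finite-to-one if there is an $M$ such that each point of its codomain has at most $M$ preimages. The "or" in (2)–(4) is inclusive. *)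

theory Defs
  imports Complex_Main
begin

text \<open>
  The symbols 1 and 0 are rendered as \<^const>\<open>True\<close> and \<^const>\<open>False\<close>. Thus the full 2-shift
  is the whole type \<open>int \<Rightarrow> bool\<close>, a block is a \<open>bool list\<close>, and bitwise complementation of
  blocks is \<open>map Not\<close>. The block of \<open>x\<close> on the coordinates \<open>i, \<dots>, j\<close> is \<open>map x [i..j]\<close>.
\<close>

type_synonym point = "int \<Rightarrow> bool"

definition occurs_in :: "bool list \<Rightarrow> point \<Rightarrow> bool" where
  "occurs_in w x \<longleftrightarrow> (\<exists>i j. map x [i..j] = w)"

definition avoiding_shift :: "bool list set \<Rightarrow> point set" where
  "avoiding_shift G = {x. \<forall>w\<in>G. \<not> occurs_in w x}"

definition block_map :: "bool list \<Rightarrow> bool list \<Rightarrow> bool" where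
  "block_map D w \<longleftrightarrow> w = D"

definition factor_code :: "bool list \<Rightarrow> int \<Rightarrow> int \<Rightarrow> point \<Rightarrow> point" where
  "factor_code D s t x = (\<lambda>i. block_map D (map x [i - s..i + t]))"

text \<open>The block \<open>1 0\<^sup>m 1\<close>.\<close>

definition gap_block :: "nat \<Rightarrow> bool list" where
  "gap_block m = True # replicate m False @ [True]"

text \<open>
  The second conjunct excludes infinite runs of 0's, on either side, when \<open>S\<close> is finite; for
  infinite \<open>S\<close> they are unrestricted, and in particular the all-0 point belongs to the shift.
\<close>

definition gap_shift :: "nat set \<Rightarrow> point set" where
  "gap_shift S = {x. (\<forall>m. occurs_in (gap_block m) x \<longrightarrow> m \<in> S) \<and>
     (finite S \<longrightarrow> (\<forall>i. (\<exists>j<i. x j) \<and> (\<exists>j>i. x j)))}"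

text \<open>
  The gap set of a gap shift is determined by the shift (\<open>gap_shift_inject\<close> below), so the
  description is proper whenever \<open>Y\<close> is a gap shift.
\<close>

definition gap_set :: "point set \<Rightarrow> nat set" where
  "gap_set Y = (THE S. Y = gap_shift S)"

definition standard_forbidden_set :: "point set \<Rightarrow> bool list set" where
  "standard_forbidden_set Y = {gap_block m | m. m \<notin> gap_set Y}"

definition finite_to_one :: "('a \<Rightarrow> 'b) \<Rightarrow> 'a set \<Rightarrow> 'b set \<Rightarrow> bool" where
  "finite_to_one f A B \<longleftrightarrow>
     (\<exists>M. \<forall>y\<in>B. finite {x \<in> A. f x = y} \<and> card {x \<in> A. f x = y} \<le> M)"

lemma occurs_in_gap_block_iff:
  "occurs_in (gap_block m) x \<longleftrightarrow>
     (\<exists>i. x i \<and> (\<forall>j. i < j \<and> j \<le> i + int m \<longrightarrow> \<not> x j) \<and> x (i + int m + 1))"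
proof -
  have eq: "map x [i..i + int m + 1] = gap_block m \<longleftrightarrow>
      x i \<and> (\<forall>j. i < j \<and> j \<le> i + int m \<longrightarrow> \<not> x j) \<and> x (i + int m + 1)" for i
  proof -
    have "[i..i + int m + 1] = i # [i + 1..i + int m] @ [i + int m + 1]"
      using upto_rec1[of i "i + int m + 1"] upto_rec2[of "i + 1" "i + int m + 1"] by simp
    moreover have "map x [i + 1..i + int m] = replicate m False \<longleftrightarrow>
        (\<forall>j. i < j \<and> j \<le> i + int m \<longrightarrow> \<not> x j)"
    proof
      assume "map x [i + 1..i + int m] = replicate m False"
      then have "set (map x [i + 1..i + int m]) \<subseteq> {False}" by auto
      then have "\<forall>j\<in>{i + 1..i + int m}. \<not> x j" by (simp add: image_subset_iff)
      then show "\<forall>j. i < j \<and> j \<le> i + int m \<longrightarrow> \<not> x j" by simp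
    next
      assume "\<forall>j. i < j \<and> j \<le> i + int m \<longrightarrow> \<not> x j"
      then show "map x [i + 1..i + int m] = replicate m False"
        by (intro replicate_eqI) auto
    qed
    ultimately show ?thesis by (simp add: gap_block_def)
  qed
  have "j = i + int m + 1" if "map x [i..j] = gap_block m" for i j
    using arg_cong[OF that, of length] by (simp add: gap_block_def)
  then show ?thesis unfolding occurs_in_def using eq by metis
qed

lemma gap_shift_mono_set:
  assumes "gap_shift S \<subseteq> gap_shift T" shows "S \<subseteq> T"
proof
  fix m assume m: "m \<in> S"
  define p where "p = int m + 1"
  define x :: point where "x = (\<lambda>i. p dvd i)"
  have p: "p > 0" by (simp add: p_def)
  have "n = m" if n: "occurs_in (gap_block n) x" for n
  proof -
    obtain i where i: "p dvd i" "\<forall>j. i < j \<and> j \<le> i + int n \<longrightarrow> \<not> p dvd j" "p dvd i + int n + 1"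
      using n unfolding occurs_in_gap_block_iff x_def by blast
    have "p dvd int n + 1"
      using i(1,3) by (metis add.assoc dvd_add_right_iff)
    then have "p \<le> int n + 1" by (rule zdvd_imp_le) simp
    moreover have "\<not> p \<le> int n" using i(1,2) p by (auto dest: spec[of _ "i + p"])
    ultimately show ?thesis by (simp add: p_def)
  qed
  moreover have "(\<exists>j<i. x j) \<and> (\<exists>j>i. x j)" for i
  proof
    have "\<bar>i\<bar> + 1 \<le> p * (\<bar>i\<bar> + 1)" using p mult_right_mono[of 1 p "\<bar>i\<bar> + 1"] by simp
    then have "- (p * (\<bar>i\<bar> + 1)) < i" "p * (\<bar>i\<bar> + 1) > i" by linarith+
    then show "\<exists>j<i. x j" "\<exists>j>i. x j" unfolding x_def by (meson dvd_triv_left dvd_minus_iff)+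
  qed
  ultimately have "x \<in> gap_shift S" using m by (auto simp: gap_shift_def)
  moreover have "occurs_in (gap_block m) x"
    unfolding occurs_in_gap_block_iff x_def
    by (rule exI[of _ 0]) (auto simp: p_def dest: zdvd_imp_le)
  ultimately show "m \<in> T" using assms by (auto simp: gap_shift_def)
qed

lemma gap_shift_inject: "gap_shift S = gap_shift T \<longleftrightarrow> S = T"
  using gap_shift_mono_set by blast

lemma gap_set_gap_shift [simp]: "gap_set (gap_shift S) = S"
  by (auto simp: gap_set_def gap_shift_inject)

end

theory Submission
  imports Defs
begin

text \<open>
  Up to a shift, the factor code sends \<open>x\<close> to the indicator of the occurrences of \<open>D\<close> in \<open>x\<close>.
  Its image \<open>Y\<close> is a gap shift with infinite gap set, so \<open>X\<^sub>\<F>\<close> is \<open>Y\<close> itself; complementing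
  \<open>D\<close> changes neither \<open>Y\<close> nor \<open>\<F>\<close> and exchanges \<open>X\<^sub>\<F>\<close> with the shift of the complemented
  forbidden set. It therefore suffices to study the factor code on \<open>Y\<close>. If \<open>D\<close> has exactly one 1,
  it acts on \<open>Y\<close> as a shift; if \<open>D\<close> is all 0's, it is inverted by widening each 1 to a
  run of \<open>k\<close> 0's.

  Now let \<open>D\<close> contain two 1's and a 0, and suppose that the factor code maps \<open>Y\<close> onto \<open>Y\<close>. Then
  \<open>D\<close> occurs in a point of \<open>Y\<close>, so the distance \<open>n\<close> of its first two 1's is an allowed gap, that is,
  two copies of \<open>D\<close> fit together at distance \<open>n\<close>. Hence \<open>D\<close> has period \<open>n \<ge> 2\<close> and no distance
  \<open>e < n\<close> is allowed. Placing two copies of \<open>D\<close> so that the last 1 of the first copy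
  and the first 1 of the second have distance \<open>n - 1\<close> (or \<open>n + 1\<close>, if \<open>D\<close> begins or ends with
  \<open>n - 1\<close> 0's) forces a forbidden distance in every preimage.
\<close>

section \<open>Occurrences of \<open>D\<close> and gaps between them\<close>

definition occurs_at :: "bool list \<Rightarrow> point \<Rightarrow> point" where
  "occurs_at D x i \<longleftrightarrow> (\<forall>j<length D. x (i + int j) = D ! j)"

text \<open>The \<open>m\<close> zeros between two 1's of an image point put consecutive copies of
  \<open>D\<close> at distance \<open>m + 1\<close>; these copies may overlap.\<close>

definition gap_lengths :: "bool list \<Rightarrow> nat set" where
  "gap_lengths D = {m. \<exists>z. occurs_at D z 0 \<and> occurs_at D z (int m + 1) \<and>
     (\<forall>j. 0 < j \<and> j \<le> int m \<longrightarrow> \<not> occurs_at D z j)}"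

lemma occurs_atD: "occurs_at D x i \<Longrightarrow> j < length D \<Longrightarrow> x (i + int j) = D ! j"
  by (simp add: occurs_at_def)

lemma occurs_at_shift: "occurs_at D (\<lambda>j. x (j + c)) i = occurs_at D x (i + c)"
  by (simp add: occurs_at_def algebra_simps)

lemma occurs_at_Not: "occurs_at D (\<lambda>i. \<not> x i) = occurs_at (map Not D) x"
  by (auto simp: occurs_at_def fun_eq_iff)

lemma factor_code_eq:
  assumes "s + t + 1 = int (length D)"
  shows "factor_code D s t x = occurs_at D (\<lambda>j. x (j - s))"
proof
  fix i
  have "map x [i - s..i + t] = D \<longleftrightarrow> (\<forall>j<length D. x (i - s + int j) = D ! j)"
    using assms by (auto simp: list_eq_iff_nth_eq)
  then show "factor_code D s t x i = occurs_at D (\<lambda>j. x (j - s)) i"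
    by (simp add: factor_code_def block_map_def occurs_at_def algebra_simps)
qed

lemma first_after:
  fixes q :: int
  assumes "P q" "i < q"
  obtains r where "i < r" "r \<le> q" "P r" "\<And>j. i < j \<Longrightarrow> j < r \<Longrightarrow> \<not> P j"
proof -
  let ?Q = "\<lambda>n. P (i + 1 + int n)"
  have q: "?Q (nat (q - i - 1))" using assms by simp
  define n where "n = (LEAST n. ?Q n)"
  have "?Q n" unfolding n_def using q by (rule LeastI)
  moreover have "\<not> P j" if "i < j" "j < i + 1 + int n" for j
    using not_less_Least[of "nat (j - i - 1)" ?Q] that by (auto simp: n_def)
  moreover have "n \<le> nat (q - i - 1)" unfolding n_def using q by (rule Least_le)
  then have "i + 1 + int n \<le> q" using assms by linarith
  ultimately show ?thesis using that[of "i + 1 + int n"] by simp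
qed

text \<open>Reflection at 0 reduces this to \<open>first_after\<close>; the start
  \<open>- i - 1\<close> turns the strict bound there into \<open>p \<le> i\<close>.\<close>

lemma last_before:
  fixes p :: int
  assumes "P p" "p \<le> i"
  obtains r where "p \<le> r" "r \<le> i" "P r" "\<And>j. r < j \<Longrightarrow> j \<le> i \<Longrightarrow> \<not> P j"
proof -
  obtain r where r: "- i - 1 < r" "r \<le> - p" "P (- r)"
      "\<And>j. - i - 1 < j \<Longrightarrow> j < r \<Longrightarrow> \<not> P (- j)"
    using first_after[of "\<lambda>j. P (- j)" "- p" "- i - 1"] assms by auto
  show ?thesis
  proof (rule that[of "- r"])
    show "\<not> P j" if "- r < j" "j \<le> i" for j using r(4)[of "- j"] that by simp
  qed (use r in auto)
qed

subsection \<open>The image of the factor code is a gap shift\<close>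

text \<open>Padding by the complement of the first symbol on the left and of the last symbol on the
  right spoils the first or last symbol of any other copy. Such a point later fills half-infinite
  runs of 0's.\<close>

lemma exists_point_occurs_at_once:
  assumes "D \<noteq> []"
  obtains x where "occurs_at D x 0" "\<And>i. occurs_at D x i \<Longrightarrow> i = 0"
proof -
  define k where "k = length D"
  define x :: point where
    "x = (\<lambda>i. if i < 0 then \<not> D ! 0 else if i < int k then D ! nat i else \<not> D ! (k - 1))"
  have k: "k \<ge> 1" using assms by (simp add: k_def Suc_le_eq)
  have "occurs_at D x 0" by (simp add: occurs_at_def x_def k_def)
  moreover have "i = 0" if i: "occurs_at D x i" for i
  proof (rule ccontr)
    assume "i \<noteq> 0"
    then consider "i < 0" | "i > 0" by linarith
    then show False
    proof cases
      case 1
      then show ?thesis using occurs_atD[OF i, of 0] assms by (simp add: x_def)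
    next
      case 2
      have "x (i + int (k - 1)) = D ! (k - 1)" using occurs_atD[OF i, of "k - 1"] k by (simp add: k_def)
      moreover have "i + int (k - 1) \<ge> int k" using 2 k by simp
      ultimately show ?thesis using k by (simp add: x_def)
    qed
  qed
  ultimately show ?thesis by (rule that)
qed

text \<open>An infinite gap set leaves infinite runs of 0's unrestricted, so the gap shift is cut
  out by forbidden blocks alone.\<close>

lemma gap_lengths_infinite:
  assumes "D \<noteq> []"
  shows "infinite (gap_lengths D)"
proof -
  define k where "k = length D"
  have k: "k \<ge> 1" using assms by (simp add: k_def Suc_le_eq)
  have "m \<in> gap_lengths D" if m: "m \<ge> 2 * k" for m
  proof -
    \<comment> \<open>A filler \<open>c\<close> different from the last symbol of \<open>D\<close> could only occur in a spurious copy of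
      \<open>D\<close> as a prefix, and then \<open>D\<close> would be constantly \<open>c\<close>.\<close>
    define c where "c \<longleftrightarrow> \<not> D ! (k - 1)"
    define d where "d = int m + 1"
    define z :: point where
      "z = (\<lambda>i. if i < int k then D ! nat i else if i < d then c else D ! nat (i - d))"
    have d: "d > 2 * int k" using m by (simp add: d_def)
    have "occurs_at D z 0" by (simp add: occurs_at_def z_def k_def)
    moreover have "occurs_at D z d" using d by (simp add: occurs_at_def z_def)
    moreover have "\<not> occurs_at D z j" if j: "0 < j" "j \<le> int m" for j
    proof
      assume o: "occurs_at D z j"
      have e: "z (j + int (k - 1)) = D ! (k - 1)" using occurs_atD[OF o, of "k - 1"] k by (simp add: k_def)
      have "\<not> (j + int (k - 1) < d)"
      proof
        assume "j + int (k - 1) < d"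
        then have "z (j + int (k - 1)) = c" using j k by (simp add: z_def)
        then show False using e by (simp add: c_def)
      qed
      then have jk: "j + int k > d" "j > int k" using d k by linarith+
      have "D ! l = c" if "l < k" for l using that
      proof (induction l rule: less_induct)
        case (less l)
        have l: "D ! l = z (j + int l)" using occurs_atD[OF o, of l] less.prems by (simp add: k_def)
        show ?case
        proof (cases "j + int l < d")
          case True
          then show ?thesis using l jk by (simp add: z_def)
        next
          case False
          have "D ! l = D ! nat (j + int l - d)" using l False jk by (simp add: z_def)
          moreover have "nat (j + int l - d) < l" using False j by (simp add: d_def)
          ultimately show ?thesis using less.IH[of "nat (j + int l - d)"] less.prems by simp
        qed
      qed
      from this[of "k - 1"] show False using k by (simp add: c_def)
    qed
    ultimately show ?thesis unfolding gap_lengths_def d_def by blast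
  qed
  then have "{2 * k..} \<subseteq> gap_lengths D" by auto
  then show ?thesis using infinite_Ici infinite_super by blast
qed

text \<open>Two copies at distance \<open>m + 1\<close> read their overlap in the same
  coordinates.\<close>

lemma gap_lengths_period:
  assumes "m \<in> gap_lengths D" "l + Suc m < length D"
  shows "D ! (l + Suc m) = D ! l"
proof -
  obtain z where z: "occurs_at D z 0" "occurs_at D z (int m + 1)"
    using assms(1) by (auto simp: gap_lengths_def)
  have e: "int m + 1 + int l = 0 + int (l + Suc m)" by simp
  have "z (int m + 1 + int l) = D ! l" using occurs_atD[OF z(2), of l] assms(2) by simp
  then have "z (0 + int (l + Suc m)) = D ! l" unfolding e .
  then show ?thesis using occurs_atD[OF z(1) assms(2)] by simp
qed

lemma gap_shift_infinite:
  assumes "infinite S"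
  shows "x \<in> gap_shift S \<longleftrightarrow> (\<forall>m. occurs_in (gap_block m) x \<longrightarrow> m \<in> S)"
  using assms by (simp add: gap_shift_def)

lemma gap_shift_consecutive:
  assumes "y \<in> gap_shift S" "y p" "y q" "p < q" "\<And>j. p < j \<Longrightarrow> j < q \<Longrightarrow> \<not> y j"
  shows "nat (q - p - 1) \<in> S"
proof -
  have "occurs_in (gap_block (nat (q - p - 1))) y"
    unfolding occurs_in_gap_block_iff by (rule exI[of _ p]) (use assms in auto)
  then show ?thesis using assms(1) by (simp add: gap_shift_def)
qed

lemma range_occurs_at_subset:
  assumes "D \<noteq> []"
  shows "range (occurs_at D) \<subseteq> gap_shift (gap_lengths D)"
proof
  fix y assume "y \<in> range (occurs_at D)"
  then obtain x where y: "y = occurs_at D x" by blast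
  have "m \<in> gap_lengths D" if m: "occurs_in (gap_block m) y" for m
  proof -
    obtain i where i: "y i" "\<And>j. i < j \<and> j \<le> i + int m \<Longrightarrow> \<not> y j" "y (i + int m + 1)"
      using m unfolding occurs_in_gap_block_iff by blast
    have "\<not> occurs_at D (\<lambda>j. x (j + i)) j" if "0 < j \<and> j \<le> int m" for j
      using i(2)[of "j + i"] that by (simp add: occurs_at_shift y)
    moreover have "occurs_at D (\<lambda>j. x (j + i)) 0" "occurs_at D (\<lambda>j. x (j + i)) (int m + 1)"
      using i by (simp_all add: occurs_at_shift y algebra_simps)
    ultimately show ?thesis unfolding gap_lengths_def by blast
  qed
  then show "y \<in> gap_shift (gap_lengths D)"
    using gap_lengths_infinite[OF assms] by (simp add: gap_shift_infinite)
qed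

text \<open>A preimage is glued from gap witnesses between consecutive 1's and points with a single
  copy of \<open>D\<close> along half-infinite runs of 0's. Copies may extend across the seams, so
  both their presence and the absence of others need an argument.\<close>

lemma gap_shift_subset_range:
  assumes "D \<noteq> []"
  shows "gap_shift (gap_lengths D) \<subseteq> range (occurs_at D)"
proof
  fix y assume y: "y \<in> gap_shift (gap_lengths D)"
  define k where "k = length D"
  have k: "k \<ge> 1" using assms by (simp add: k_def Suc_le_eq)
  obtain u where u: "occurs_at D u 0" "\<And>i. occurs_at D u i \<Longrightarrow> i = 0"
    using exists_point_occurs_at_once[OF assms] by blast
  have "\<forall>m\<in>gap_lengths D. \<exists>z. occurs_at D z 0 \<and> occurs_at D z (int m + 1) \<and>
     (\<forall>j. 0 < j \<and> j \<le> int m \<longrightarrow> \<not> occurs_at D z j)"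
    by (simp add: gap_lengths_def)
  from bchoice[OF this] obtain w where
    "\<forall>m\<in>gap_lengths D. occurs_at D (w m) 0 \<and> occurs_at D (w m) (int m + 1) \<and>
       (\<forall>j. 0 < j \<and> j \<le> int m \<longrightarrow> \<not> occurs_at D (w m) j)" ..
  then have w: "occurs_at D (w m) 0" "occurs_at D (w m) (int m + 1)"
      "\<And>j. 0 < j \<Longrightarrow> j \<le> int m \<Longrightarrow> \<not> occurs_at D (w m) j" if "m \<in> gap_lengths D" for m
    using that by blast+
  have before: "\<exists>p\<le>i. y p \<and> (\<forall>j. p < j \<and> j \<le> i \<longrightarrow> \<not> y j)" if ex: "\<exists>p\<le>i. y p" for i
  proof -
    from ex obtain p where "p \<le> i" "y p" by blast
    with last_before[of y p i]
    obtain r where "r \<le> i" "y r" "\<And>j. r < j \<Longrightarrow> j \<le> i \<Longrightarrow> \<not> y j" by metis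
    then show ?thesis by blast
  qed
  have after: "\<exists>q>i. y q \<and> (\<forall>j. i < j \<and> j < q \<longrightarrow> \<not> y j)" if ex: "\<exists>q>i. y q" for i
  proof -
    from ex obtain q where "i < q" "y q" by blast
    then obtain r where "i < r" "y r" "\<And>j. i < j \<Longrightarrow> j < r \<Longrightarrow> \<not> y j"
      using first_after[of y q i] by blast
    then show ?thesis by blast
  qed
  \<comment> \<open>The \<open>THE\<close> terms are meaningful only where such a 1 exists. With
    \<open>\<le>\<close> before and \<open><\<close> after, a coordinate carrying a 1 belongs to the
    piece on its right.\<close>
  define pr where "pr i = (THE p. p \<le> i \<and> y p \<and> (\<forall>j. p < j \<and> j \<le> i \<longrightarrow> \<not> y j))" for i
  define nx where "nx i = (THE q. i < q \<and> y q \<and> (\<forall>j. i < j \<and> j < q \<longrightarrow> \<not> y j))" for i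
  have pr: "pr i = p" if "p \<le> i" "y p" "\<And>j. p < j \<Longrightarrow> j \<le> i \<Longrightarrow> \<not> y j" for i p
    unfolding pr_def
  proof (rule the_equality)
    fix r assume r: "r \<le> i \<and> y r \<and> (\<forall>j. r < j \<and> j \<le> i \<longrightarrow> \<not> y j)"
    show "r = p" using r that(1,2) that(3)[of r] by (cases r p rule: linorder_cases) blast+
  qed (use that in blast)
  have nx: "nx i = q" if "i < q" "y q" "\<And>j. i < j \<Longrightarrow> j < q \<Longrightarrow> \<not> y j" for i q
    unfolding nx_def
  proof (rule the_equality)
    fix r assume r: "i < r \<and> y r \<and> (\<forall>j. i < j \<and> j < r \<longrightarrow> \<not> y j)"
    show "r = q" using r that(1,2) that(3)[of r] by (cases r q rule: linorder_cases) blast+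
  qed (use that in blast)
  \<comment> \<open>Each piece is translated so that its copy of \<open>D\<close> at 0 lands on a 1
    bounding it. If \<open>y\<close> has no 1, the constant \<open>\<not> D ! 0\<close> excludes
    \<open>D\<close>.\<close>
  define x :: point where "x = (\<lambda>i.
    if \<exists>p\<le>i. y p
    then if \<exists>q>i. y q then w (nat (nx i - pr i - 1)) (i - pr i) else u (i - pr i)
    else if \<exists>q>i. y q then u (i - nx i) else \<not> D ! 0)"
  have x_mid: "x i = w (nat (q - p - 1)) (i - p)"
    if "y p" "y q" "\<And>j. p < j \<Longrightarrow> j < q \<Longrightarrow> \<not> y j" "p \<le> i" "i < q" for p q i
  proof -
    have "pr i = p" using that by (intro pr) auto
    moreover have "nx i = q" using that by (intro nx) auto
    moreover have "\<exists>p\<le>i. y p" "\<exists>q>i. y q" using that by blast+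
    ultimately show ?thesis by (simp only: x_def if_True if_False)
  qed
  have x_right: "x i = u (i - p)" if "y p" "\<And>j. p < j \<Longrightarrow> \<not> y j" "p \<le> i" for p i
  proof -
    have "pr i = p" using that by (intro pr) auto
    moreover have "\<exists>p\<le>i. y p" "\<not> (\<exists>q>i. y q)" using that by (blast, force)
    ultimately show ?thesis by (simp only: x_def if_True if_False)
  qed
  have x_left: "x i = u (i - q)" if "y q" "\<And>j. j < q \<Longrightarrow> \<not> y j" "i < q" for q i
  proof -
    have "nx i = q" using that by (intro nx) auto
    moreover have "\<not> (\<exists>p\<le>i. y p)" "\<exists>q>i. y q" using that by (force, blast)
    ultimately show ?thesis by (simp only: x_def if_True if_False)
  qed
  \<comment> \<open>The next 1 of \<open>y\<close> may come before this copy of \<open>D\<close> ends; the rest of the copy is then a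
    prefix of the next one, whence an induction on the position within \<open>D\<close>.\<close>
  have occ: "x (p + int j) = D ! j" if "y p" "j < k" for p j
    using that
  proof (induction j arbitrary: p rule: less_induct)
    case (less j)
    show ?case
    proof (cases "\<exists>q>p. y q")
      case False
      then have "x (p + int j) = u (p + int j - p)" using less.prems by (intro x_right) auto
      then show ?thesis using occurs_atD[OF u(1), of j] less.prems by (simp add: k_def)
    next
      case True
      then obtain q where q: "p < q" "y q" "\<And>j. p < j \<Longrightarrow> j < q \<Longrightarrow> \<not> y j"
        using after[OF True] by blast
      define m where "m = nat (q - p - 1)"
      have m: "m \<in> gap_lengths D"
        unfolding m_def using gap_shift_consecutive[OF y less.prems(1) q(2,1,3)] .
      have wj: "w m (int j) = D ! j" using occurs_atD[OF w(1)[OF m], of j] less.prems by (simp add: k_def)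
      show ?thesis
      proof (cases "p + int j < q")
        case True
        then have "x (p + int j) = w m (p + int j - p)"
          unfolding m_def using less.prems q by (intro x_mid) auto
        then show ?thesis using wj by simp
      next
        case False
        define j' where "j' = nat (p + int j - q)"
        have j': "j' < j" "p + int j = q + int j'" "int m + 1 + int j' = int j"
          using False q(1) by (auto simp: j'_def m_def)
        have "x (p + int j) = D ! j'" using less.IH[OF j'(1) q(2)] j' less.prems by simp
        also have "\<dots> = w m (int j)"
          using occurs_atD[OF w(2)[OF m], of j'] j' less.prems by (simp add: k_def)
        finally show ?thesis using wj by simp
      qed
    qed
  qed
  have "occurs_at D x i = y i" for i
  proof
    assume "y i"
    then show "occurs_at D x i" using occ by (simp add: occurs_at_def k_def)
  next
    \<comment> \<open>If \<open>y\<close> has a 1, the copy of \<open>D\<close> at \<open>i\<close>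
      is transported into \<open>w\<close> or \<open>u\<close>, where no copy may start: beyond a
      next 1 at \<open>q\<close>, both \<open>x\<close> and the piece continue with the copy of
      \<open>D\<close> at \<open>q\<close>.\<close>
    assume o: "occurs_at D x i"
    show "y i"
    proof (rule ccontr)
      assume ni: "\<not> y i"
      consider (both) "\<exists>p\<le>i. y p" "\<exists>q>i. y q" | (left) "\<exists>p\<le>i. y p" "\<not> (\<exists>q>i. y q)"
        | (right) "\<not> (\<exists>p\<le>i. y p)" "\<exists>q>i. y q" | (none) "\<not> (\<exists>p\<le>i. y p)" "\<not> (\<exists>q>i. y q)"
        by blast
      then show False
      proof cases
        case both
        obtain p where p: "p \<le> i" "y p" "\<And>j. p < j \<Longrightarrow> j \<le> i \<Longrightarrow> \<not> y j"
          using before[OF both(1)] by blast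
        obtain q where q: "i < q" "y q" "\<And>j. i < j \<Longrightarrow> j < q \<Longrightarrow> \<not> y j"
          using after[OF both(2)] by blast
        have pq: "\<not> y j" if "p < j" "j < q" for j using p(3) q(3) that by (meson not_le)
        define m where "m = nat (q - p - 1)"
        have m: "m \<in> gap_lengths D"
          unfolding m_def using gap_shift_consecutive[OF y p(2) q(2) _ pq] p q by simp
        have "w m (i - p + int j) = D ! j" if j: "j < k" for j
        proof (cases "i + int j < q")
          case True
          then have "x (i + int j) = w m (i + int j - p)"
            unfolding m_def using p q pq by (intro x_mid) auto
          then show ?thesis using occurs_atD[OF o, of j] j by (simp add: k_def algebra_simps)
        next
          case False
          define j' where "j' = nat (i + int j - q)"
          have j': "j' < k" "i + int j = q + int j'" "int m + 1 + int j' = i - p + int j"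
            using False p(1) q(1) j by (auto simp: j'_def m_def)
          have "x (i + int j) = D ! j'" unfolding j'(2) by (rule occ[OF q(2) j'(1)])
          also have "\<dots> = w m (i - p + int j)"
            using occurs_atD[OF w(2)[OF m], of j'] j' by (simp add: k_def)
          finally show ?thesis using occurs_atD[OF o, of j] j by (simp add: k_def)
        qed
        then have "occurs_at D (w m) (i - p)" by (simp add: occurs_at_def k_def)
        moreover have "p \<noteq> i" using p ni by auto
        ultimately show False using w(3)[OF m, of "i - p"] p q by (simp add: m_def)
      next
        case left
        obtain p where p: "p \<le> i" "y p" "\<And>j. p < j \<Longrightarrow> j \<le> i \<Longrightarrow> \<not> y j"
          using before[OF left(1)] by blast
        have "\<not> y j" if "p < j" for j using p(3) left(2) that by (meson not_le)
        then have "x (i + int j) = u (i + int j - p)" for j using p by (intro x_right) auto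
        then have "occurs_at D u (i - p)" using o by (simp add: occurs_at_def algebra_simps)
        then have "i - p = 0" by (rule u(2))
        then show False using p ni by simp
      next
        case right
        obtain q where q: "i < q" "y q" "\<And>j. i < j \<Longrightarrow> j < q \<Longrightarrow> \<not> y j"
          using after[OF right(2)] by blast
        have "u (i - q + int j) = D ! j" if j: "j < k" for j
        proof (cases "i + int j < q")
          case True
          have "\<not> y l" if "l < q" for l using q(3) right(1) that by (meson not_le)
          then have "x (i + int j) = u (i + int j - q)" using x_left[OF q(2) _ True] by blast
          then show ?thesis using occurs_atD[OF o, of j] j by (simp add: k_def algebra_simps)
        next
          case False
          define j' where "j' = nat (i + int j - q)"
          have j': "j' < k" "i + int j = q + int j'" "int j' = i - q + int j"
            using False q(1) j by (auto simp: j'_def)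
          have "x (i + int j) = D ! j'" unfolding j'(2) by (rule occ[OF q(2) j'(1)])
          also have "\<dots> = u (i - q + int j)"
            using occurs_atD[OF u(1), of j'] j' by (simp add: k_def)
          finally show ?thesis using occurs_atD[OF o, of j] j by (simp add: k_def)
        qed
        then have "occurs_at D u (i - q)" by (simp add: occurs_at_def k_def)
        then have "i - q = 0" by (rule u(2))
        then show False using q by simp
      next
        case none
        then have "x i \<longleftrightarrow> \<not> D ! 0" by (simp only: x_def if_False)
        then show False using occurs_atD[OF o, of 0] assms by simp
      qed
    qed
  qed
  then show "y \<in> range (occurs_at D)" by (intro image_eqI[of _ _ x]) auto
qed

lemma range_occurs_at: "D \<noteq> [] \<Longrightarrow> range (occurs_at D) = gap_shift (gap_lengths D)"
  using range_occurs_at_subset gap_shift_subset_range by blast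

text \<open>As the gap set is infinite, lying in the gap shift means exactly avoiding the forbidden
  gap blocks.\<close>

lemma avoiding_standard_forbidden_set:
  assumes "D \<noteq> []"
  shows "avoiding_shift (standard_forbidden_set (range (occurs_at D))) = range (occurs_at D)"
proof -
  have "standard_forbidden_set (gap_shift S) = gap_block ` (- S)" for S
    by (auto simp: standard_forbidden_set_def)
  then show ?thesis
    using gap_lengths_infinite[OF assms]
    by (auto simp: range_occurs_at[OF assms] avoiding_shift_def gap_shift_infinite)
qed

lemma range_occurs_at_shift:
  assumes "x \<in> range (occurs_at D)"
  shows "(\<lambda>i. x (i + c)) \<in> range (occurs_at D)"
proof -
  obtain z where "x = occurs_at D z" using assms by blast
  then have "(\<lambda>i. x (i + c)) = occurs_at D (\<lambda>j. z (j + c))"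
    by (simp add: fun_eq_iff occurs_at_shift)
  then show ?thesis by blast
qed

subsection \<open>Blocks with at most one 1\<close>

text \<open>The sole 1 of \<open>D\<close>, at \<open>a\<close>, keeps copies of \<open>D\<close>
  apart, so in an image point every 1 is surrounded by the 0's that \<open>D\<close> requires. On
  the image the code is translation by \<open>a\<close>.\<close>

lemma single_True_inj_onto:
  assumes a: "a < length D" "\<And>j. j < length D \<Longrightarrow> D ! j \<longleftrightarrow> j = a"
  shows "inj_on (occurs_at D) (range (occurs_at D))"
    and "occurs_at D ` range (occurs_at D) = range (occurs_at D)"
proof -
  \<comment> \<open>Either the 1 of the first copy meets index \<open>a - n\<close> of the second,
    or the 1 of the second meets index \<open>a + n\<close> of the first; \<open>D\<close> has 0 at
    both indices.\<close>
  have disj: False if z: "occurs_at D z p" "occurs_at D z (p + int n)"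
    and n: "n > 0" "n \<le> a \<or> a + n < length D" for z p n
  proof (cases "n \<le> a")
    case True
    have "z (p + int a)" using occurs_atD[OF z(1) a(1)] a by simp
    moreover have "\<not> z (p + int n + int (a - n))" using occurs_atD[OF z(2), of "a - n"] a n True by simp
    ultimately show False using True by simp
  next
    case False
    have "z (p + int n + int a)" using occurs_atD[OF z(2) a(1)] a by simp
    moreover have "\<not> z (p + int (a + n))" using occurs_atD[OF z(1), of "a + n"] a n False by simp
    ultimately show False by (simp add: algebra_simps)
  qed
  have eq: "occurs_at D x = (\<lambda>i. x (i + int a))" if "x \<in> range (occurs_at D)" for x
  proof
    fix i
    from that obtain z where z: "x = occurs_at D z" by blast
    show "occurs_at D x i = x (i + int a)"
    proof
      assume "occurs_at D x i"
      then show "x (i + int a)" using occurs_atD a by blast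
    next
      assume xa: "x (i + int a)"
      have "\<not> x (i + int j)" if j: "j < length D" "j \<noteq> a" for j
      proof
        assume "x (i + int j)"
        then have xj: "occurs_at D z (i + int j)" and xa': "occurs_at D z (i + int a)"
          using xa by (simp_all add: z)
        show False
        proof (cases "j < a")
          case True
          then have "i + int a = i + int j + int (a - j)" by simp
          then show False using disj[OF xj, of "a - j"] xa' True by simp
        next
          case False
          then have "i + int j = i + int a + int (j - a)" by simp
          then show False using disj[OF xa', of "j - a"] xj False j by simp
        qed
      qed
      then show "occurs_at D x i" using xa a by (auto simp: occurs_at_def)
    qed
  qed
  show "inj_on (occurs_at D) (range (occurs_at D))"
  proof (rule inj_onI)
    fix x x' assume "x \<in> range (occurs_at D)" "x' \<in> range (occurs_at D)" "occurs_at D x = occurs_at D x'"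
    then have "(\<lambda>i. x (i + int a)) = (\<lambda>i. x' (i + int a))" using eq by metis
    from fun_cong[OF this, of "_ - int a"] show "x = x'" by auto
  qed
  have "y \<in> occurs_at D ` range (occurs_at D)" if y: "y \<in> range (occurs_at D)" for y
  proof (rule image_eqI)
    show s: "(\<lambda>i. y (i + - int a)) \<in> range (occurs_at D)" by (rule range_occurs_at_shift[OF y])
    show "y = occurs_at D (\<lambda>i. y (i + - int a))" using eq[OF s] by simp
  qed
  then show "occurs_at D ` range (occurs_at D) = range (occurs_at D)" by blast
qed

text \<open>The code marks the starts of all-0 windows of length \<open>k\<close>. Dilating each
  mark to its window undoes this on points whose 0's form a union of such windows, and these points
  make up the image.\<close>

lemma no_True_inj_onto:
  assumes "D \<noteq> []" and D: "\<And>j. j < length D \<Longrightarrow> \<not> D ! j"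
  shows "inj_on (occurs_at D) (range (occurs_at D))"
    and "occurs_at D ` range (occurs_at D) = range (occurs_at D)"
proof -
  define k where "k = int (length D)"
  have k: "k \<ge> 1" using assms(1) by (simp add: k_def Suc_le_eq)
  have occ: "occurs_at D x i \<longleftrightarrow> (\<forall>j. i \<le> j \<and> j < i + k \<longrightarrow> \<not> x j)" for x i
  proof
    assume o: "occurs_at D x i"
    show "\<forall>j. i \<le> j \<and> j < i + k \<longrightarrow> \<not> x j"
    proof (intro allI impI)
      fix j assume "i \<le> j \<and> j < i + k"
      then have "nat (j - i) < length D" "i + int (nat (j - i)) = j" by (auto simp: k_def)
      then show "\<not> x j" using occurs_atD[OF o, of "nat (j - i)"] D[of "nat (j - i)"] by simp
    qed
  qed (simp add: occurs_at_def D k_def)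
  define wide where "wide x \<longleftrightarrow>
    (\<forall>i. \<not> x i \<longrightarrow> (\<exists>q\<le>i. i < q + k \<and> (\<forall>j. q \<le> j \<and> j < q + k \<longrightarrow> \<not> x j)))" for x :: point
  define dil :: "point \<Rightarrow> point" where "dil y = (\<lambda>i. \<not> (\<exists>j\<le>i. i < j + k \<and> y j))" for y
  have wide_range: "wide x" if "x \<in> range (occurs_at D)" for x
    unfolding wide_def
  proof (intro allI impI)
    fix i assume i: "\<not> x i"
    from that obtain z where z: "x = occurs_at D z" by blast
    obtain j where j: "i \<le> j" "j < i + k" "z j" using i by (auto simp: z occ)
    \<comment> \<open>The 1 of \<open>z\<close> at \<open>j\<close> spoils all \<open>k\<close>
      windows containing \<open>j\<close>.\<close>
    have "\<not> x l" if "j - k + 1 \<le> l \<and> l < j - k + 1 + k" for l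
      using j that by (auto simp: z occ)
    then show "\<exists>q\<le>i. i < q + k \<and> (\<forall>j. q \<le> j \<and> j < q + k \<longrightarrow> \<not> x j)"
      using j by (intro exI[of _ "j - k + 1"]) auto
  qed
  have wide_dil: "wide (dil y)" for y
    unfolding wide_def dil_def by (auto intro: k)
  have occ_dil: "occurs_at D (dil y) = y" if "wide y" for y
  proof
    fix p
    show "occurs_at D (dil y) p = y p"
    proof
      show "occurs_at D (dil y) p" if "y p" using that by (auto simp: occ dil_def)
    next
      assume o: "occurs_at D (dil y) p"
      show "y p"
      proof (rule ccontr)
        assume "\<not> y p"
        then obtain q where q: "q \<le> p" "p < q + k" "\<And>j. q \<le> j \<Longrightarrow> j < q + k \<Longrightarrow> \<not> y j"
          using \<open>wide y\<close> unfolding wide_def by blast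
        \<comment> \<open>Coordinate \<open>q + k - 1\<close> lies in the window at
          \<open>p\<close>, so the window of some 1 of \<open>y\<close> covers it; that 1 would lie
          in the block of 0's starting at \<open>q\<close>.\<close>
        have "\<not> dil y (q + k - 1)" using o q by (auto simp: occ)
        then show False using q(3) by (auto simp: dil_def)
      qed
    qed
  qed
  have dil_occ: "dil (occurs_at D x) = x" if "x \<in> range (occurs_at D)" for x
  proof
    fix i
    show "dil (occurs_at D x) i = x i"
      using wide_range[OF that] unfolding wide_def dil_def occ by blast
  qed
  show "inj_on (occurs_at D) (range (occurs_at D))"
    by (rule inj_on_inverseI) (rule dil_occ)
  have "y \<in> occurs_at D ` range (occurs_at D)" if y: "y \<in> range (occurs_at D)" for y
  proof (rule image_eqI)
    show "y = occurs_at D (dil y)" using occ_dil wide_range y by simp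
    have "dil y = occurs_at D (dil (dil y))" using occ_dil wide_dil by simp
    then show "dil y \<in> range (occurs_at D)" by blast
  qed
  then show "occurs_at D ` range (occurs_at D) = range (occurs_at D)" by blast
qed

lemma count_list_True: "count_list D True = card {i. i < length D \<and> D ! i}"
  by (simp add: count_list_eq_length_filter length_filter_conv_card)

lemma count_list_True_le_1:
  assumes "count_list D True \<le> 1"
  shows "(\<forall>j<length D. \<not> D ! j) \<or> (\<exists>a<length D. \<forall>j<length D. D ! j \<longleftrightarrow> j = a)"
proof -
  have "card {i. i < length D \<and> D ! i} \<le> Suc 0" using assms by (simp add: count_list_True)
  then have "\<forall>i\<in>{i. i < length D \<and> D ! i}. \<forall>j\<in>{i. i < length D \<and> D ! i}. i = j"
    by (subst (asm) card_le_Suc0_iff_eq) auto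
  then show ?thesis by blast
qed

lemma few_True_inj_onto:
  assumes "D \<noteq> []" "count_list D True \<le> 1"
  shows "inj_on (occurs_at D) (range (occurs_at D)) \<and>
    occurs_at D ` range (occurs_at D) = range (occurs_at D)"
  using count_list_True_le_1[OF assms(2)] single_True_inj_onto no_True_inj_onto[OF assms(1)]
  by metis

subsection \<open>Blocks with two 1s and a 0\<close>

lemma two_True_not_onto:
  assumes "count_list D True \<ge> 2" and "count_list D False \<ge> 1"
  shows "occurs_at D ` range (occurs_at D) \<noteq> range (occurs_at D)"
proof
  assume onto: "occurs_at D ` range (occurs_at D) = range (occurs_at D)"
  define k where "k = length D"
  have Dne: "D \<noteq> []" using assms by auto
  define S where "S = gap_lengths D"
  have Y: "range (occurs_at D) = gap_shift S" unfolding S_def by (rule range_occurs_at[OF Dne])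
  \<comment> \<open>Surjectivity enters in this form: the occurrences of \<open>D\<close> in any
    \<open>z\<close> are those in some point with gaps in \<open>S\<close>.\<close>
  have preimage: "\<exists>x\<in>gap_shift S. occurs_at D x = occurs_at D z" for z
    using onto Y by (metis imageE rangeI)
  have per: "D ! (l + e) = D ! l" if "e - 1 \<in> S" "e > 0" "l + e < k" for e l
    using gap_lengths_period[of "e - 1" D l] that by (simp add: S_def k_def)
  define A where "A = {i. i < k \<and> D ! i}"
  have A: "finite A" "card A \<ge> 2" using assms(1) by (simp_all add: A_def k_def count_list_True)
  then have Ane: "A \<noteq> {}" by auto
  define a where "a = Min A"
  have aA: "a \<in> A" unfolding a_def using A(1) Ane by (rule Min_in)
  have a_le: "a \<le> j" if "j \<in> A" for j using A that by (simp add: a_def)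
  have a: "a < k" "D ! a" "\<And>j. j < a \<Longrightarrow> \<not> D ! j"
    using aA a_le by (simp_all add: A_def) (meson leD less_trans)
  have A'ne: "A - {a} \<noteq> {}" using A aA by 
    (metis One_nat_def card_Suc_Diff1 card.empty numeral_2_eq_2 not_less_eq_eq order_refl)
  define a2 where "a2 = Min (A - {a})"
  have a2A: "a2 \<in> A - {a}" unfolding a2_def using A(1) A'ne by (intro Min_in) auto
  have a2_le: "a2 \<le> j" if "j \<in> A - {a}" for j using A that by (simp add: a2_def)
  have a2: "a < a2" "a2 < k" "D ! a2" using a2A a_le[of a2] by (auto simp: A_def)
  have a2': "\<not> D ! j" if "a < j" "j < a2" for j using a2_le[of j] that a2 by (auto simp: A_def)
  define n where "n = a2 - a"
  have n0: "n > 0" "a + n < k" "D ! (a + n)" "\<And>j. a < j \<Longrightarrow> j < a + n \<Longrightarrow> \<not> D ! j"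
    using a2 a2' by (auto simp: n_def)
  have "n - 1 \<in> S"
  proof -
    obtain u where u: "occurs_at D u 0" using exists_point_occurs_at_once[OF Dne] by blast
    obtain x where x: "x \<in> gap_shift S" "occurs_at D x 0" using preimage[of u] u by auto
    have xj: "x (int j) = D ! j" if "j < k" for j
      using occurs_atD[OF x(2)] that by (simp add: k_def)
    have "\<not> x j" if "int a < j" "j < int (a + n)" for j
      using xj[of "nat j"] n0(2) n0(4)[of "nat j"] that by auto
    moreover have "x (int a)" "x (int (a + n))" "int a < int (a + n)"
      using xj[of a] xj[of "a + n"] n0 a by simp_all
    ultimately have "nat (int (a + n) - int a - 1) \<in> S"
      using gap_shift_consecutive[OF x(1), of "int a" "int (a + n)"] by blast
    moreover have "nat (int (a + n) - int a - 1) = n - 1" using n0 by simp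
    ultimately show ?thesis by metis
  qed
  then have pern: "D ! (l + n) = D ! l" if "l + n < k" for l using per n0 that by blast
  \<comment> \<open>Otherwise the period \<open>n\<close> would give a 1 at \<open>a - n\<close>,
    before the first one; \<open>kL\<close> below is the mirror image.\<close>
  have an: "a < n"
    using pern[of "a - n"] a(1,2) a(3)[of "a - n"] n0(1) by (cases "a < n") auto
  have n: "n \<ge> 2"
  proof (rule ccontr)
    assume "\<not> n \<ge> 2"
    then have n1: "n = 1" using n0 by simp
    have "D ! j" if "j < k" for j using that
    proof (induction j)
      case 0 then show ?case using an a n1 by simp
    next
      case (Suc j) then show ?case using pern[of j] n1 by simp
    qed
    then show False using assms(2) by (metis count_list_0_iff in_set_conv_nth k_def not_one_le_zero)
  qed
  define L where "L = Max A"
  have "L \<in> A" unfolding L_def using A(1) Ane by (rule Max_in)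
  moreover have L_ge: "j \<le> L" if "j \<in> A" for j using A that by (simp add: L_def)
  moreover have "a + n \<in> A" using n0 by (simp add: A_def)
  ultimately have L: "L < k" "D ! L" "a + n \<le> L" "\<And>j. L < j \<Longrightarrow> j < k \<Longrightarrow> \<not> D ! j"
    by (fastforce simp: A_def)+
  have kL: "k \<le> L + n" using pern[of L] L by (metis less_add_same_cancel1 n0(1) not_le)
  \<comment> \<open>An allowed distance is a period, and \<open>e\<close> would put a 1 strictly
    between the first two.\<close>
  have small: False if "e - 1 \<in> S" "0 < e" "e < n" for e
    using per[of e a] that n0 a(2) by auto
  \<comment> \<open>Under these bounds any overlap lies after the last 1 of the first copy and
    before the first 1 of the second, so both copies demand 0's there.\<close>
  have realise: "\<exists>x\<in>gap_shift S. occurs_at D x 0 \<and> occurs_at D x (int d)"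
    if d: "L < d" "k \<le> d + a" for d
  proof -
    define z :: point where
      "z i = (if i < int d then i \<le> int L \<and> D ! nat i else D ! nat (i - int d))" for i
    have "z (int j) = D ! j" if "j < k" for j
    proof (cases "j < d")
      case True
      moreover have "D ! j \<Longrightarrow> j \<le> L" using L(4)[of j] that by (meson not_le)
      ultimately show ?thesis by (auto simp: z_def)
    next
      case False
      then have "\<not> D ! j" "\<not> D ! (j - d)" using L(4)[of j] a(3)[of "j - d"] d that by auto
      then show ?thesis using False by (simp add: z_def nat_diff_distrib)
    qed
    then have "occurs_at D z 0" by (simp add: occurs_at_def k_def)
    moreover have "occurs_at D z (int d)" by (simp add: occurs_at_def z_def)
    ultimately show ?thesis using preimage[of z] by metis
  qed
  have nextL: "\<exists>e. 0 < e \<and> e \<le> g \<and> e - 1 \<in> S \<and> x (i + int e)"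
    if "x \<in> gap_shift S" "x i" "x (i + int g)" "g > 0" for x i g
  proof -
    from that obtain r where r: "i < r" "r \<le> i + int g" "x r"
        "\<And>j. i < j \<Longrightarrow> j < r \<Longrightarrow> \<not> x j"
      using first_after[of x "i + int g" i] by auto
    have "nat (r - i) - 1 = nat (r - i - 1)" by simp
    then have "nat (r - i) - 1 \<in> S"
      using gap_shift_consecutive[OF that(1,2) r(3,1,4)] by simp
    then show ?thesis using r by (intro exI[of _ "nat (r - i)"]) auto
  qed
  show False
  proof (cases "a + 2 \<le> n \<and> k < L + n")
    case True
    \<comment> \<open>The last 1 of the first copy and the first 1 of the second get distance
      \<open>n - 1\<close>, so some distance below \<open>n\<close> would be allowed.\<close>
    define d where "d = L + (n - 1) - a"
    have "L < d" "k \<le> d + a" using True by (auto simp: d_def)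
    then obtain x where x: "x \<in> gap_shift S" "occurs_at D x 0" "occurs_at D x (int d)"
      using realise by blast
    have "x (int L)" using occurs_atD[OF x(2), of L] L by (simp add: k_def)
    moreover have "int d + int a = int L + int (n - 1)" using True by (simp add: d_def)
    then have "x (int L + int (n - 1))" using occurs_atD[OF x(3), of a] a by (simp add: k_def)
    ultimately obtain e where "0 < e" "e \<le> n - 1" "e - 1 \<in> S"
      using nextL[OF x(1), of "int L" "n - 1"] n by auto
    moreover have "e < n" using calculation n by linarith
    ultimately show False using small by blast
  next
    case False
    \<comment> \<open>Now \<open>a = n - 1\<close> or \<open>k = L + n\<close>, which violates a
      bound of \<open>realise\<close> for distance \<open>n - 1\<close>; distance
      \<open>n + 1\<close> is used instead.\<close>
    define d where "d = L + (n + 1) - a"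
    have "L < d" "k \<le> d + a" using an kL by (auto simp: d_def)
    then obtain x where x: "x \<in> gap_shift S" "occurs_at D x 0" "occurs_at D x (int d)"
      using realise by blast
    have xL: "x (int L)" using occurs_atD[OF x(2), of L] L by (simp add: k_def)
    have "int d + int a = int L + int (n + 1)" using an by (simp add: d_def)
    then have xd: "x (int L + int (n + 1))" using occurs_atD[OF x(3), of a] a by (simp add: k_def)
    obtain e where e: "0 < e" "e \<le> n + 1" "e - 1 \<in> S" "x (int L + int e)"
      using nextL[OF x(1) xL xd] by auto
    consider "e < n" | "e = n" | "e = n + 1" using e by linarith
    then show False
    proof cases
      case 1 then show ?thesis using small e by blast
    next
      case 2
      \<comment> \<open>After a step of \<open>n\<close> the remaining distance is 1, again below
        \<open>n\<close>.\<close>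
      have "x (int L + int n + int 1)" using xd by (simp add: algebra_simps)
      then obtain e' where "0 < e'" "e' \<le> 1" "e' - 1 \<in> S"
        using nextL[OF x(1), of "int L + int n" 1] e(4) 2 by auto
      then show ?thesis using small[of e'] n by simp
    next
      case 3
      \<comment> \<open>Now \<open>n + 1\<close> is a period as well. If \<open>k = L + n\<close>,
        it carries the 1 at \<open>L - n\<close> to the 0 at \<open>L + 1\<close>; if
        \<open>a = n - 1\<close>, it carries the 0 at \<open>n - 2\<close> to the 1 at
        \<open>a + n\<close>.\<close>
      show ?thesis
      proof (cases "a + 2 \<le> n")
        case True
        then have "k = L + n" using False kL by simp
        then show ?thesis
          using per[OF e(3,1), of "L - n"] 3 L(1-3) L(4)[of "L + 1"] n pern[of "L - n"] by simp
      next
        case F: False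
        then have "a = n - 1" using an by simp
        then have "n - 2 + e = a + n" "n - 2 < a" using 3 n by simp_all
        then show ?thesis using per[OF e(3,1), of "n - 2"] n0(2,3) a(3)[of "n - 2"] by simp
      qed
    qed
  qed
qed

subsection \<open>Complementation\<close>

lemma occurs_in_map_Not: "occurs_in (map Not w) x \<longleftrightarrow> occurs_in w (\<lambda>i. \<not> x i)"
proof -
  have "map x [i..j] = map Not w \<longleftrightarrow> map (\<lambda>i. \<not> x i) [i..j] = w" for i j
    by (auto simp: list_eq_iff_nth_eq)
  then show ?thesis by (simp add: occurs_in_def)
qed

lemma avoiding_shift_map_Not:
  "avoiding_shift (map Not ` G) = (\<lambda>x i. \<not> x i) ` avoiding_shift G"
proof -
  have "x \<in> avoiding_shift (map Not ` G) \<longleftrightarrow> (\<lambda>i. \<not> x i) \<in> avoiding_shift G" for x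
    by (simp add: avoiding_shift_def occurs_in_map_Not)
  then show ?thesis by (auto intro!: image_eqI[of _ _ "\<lambda>i. \<not> _ i"])
qed

text \<open>Complementing points permutes the full shift and exchanges copies of \<open>D\<close>
  with copies of \<open>map Not D\<close>.\<close>

lemma range_occurs_at_map_Not: "range (occurs_at (map Not D)) = range (occurs_at D)"
proof -
  have "occurs_at (map Not D) x \<in> range (occurs_at D)" for x and D
    by (simp flip: occurs_at_Not)
  from this[of D] this[of "map Not D"] show ?thesis by (auto simp: comp_def)
qed

lemma count_list_map_Not: "count_list (map Not D) b = count_list D (\<not> b)"
  by (induction D) auto

lemma inj_on_finite_to_one:
  assumes "inj_on f A"
  shows "finite_to_one f A B"
  unfolding finite_to_one_def
proof (intro exI[of _ 1] ballI)
  fix y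
  let ?B = "{x \<in> A. f x = y}"
  have "?B = {} \<or> (\<exists>x. ?B = {x})" using assms unfolding inj_on_def by blast
  then show "finite ?B \<and> card ?B \<le> 1" by (elim disjE exE) (simp_all only:, auto)
qed

section \<open>Removal of the translation and the cycle of implications\<close>

theorem theorem6p5:
  fixes D :: "bool list" and s t :: int
    and \<phi> :: "point \<Rightarrow> point" and Y :: "point set" and F F' :: "bool list set"
  assumes "length D \<ge> 1"
    and "s + t + 1 = int (length D)"
  defines "\<phi> \<equiv> factor_code D s t"
    and "Y \<equiv> range \<phi>"
    and "F \<equiv> standard_forbidden_set Y"
    and "F' \<equiv> map Not ` F"
  defines
    "P1 \<equiv> count_list D False \<le> 1 \<or> count_list D True \<le> 1"
    and "P2 \<equiv>
      (inj_on \<phi> (avoiding_shift F) \<and> \<phi> ` avoiding_shift F = Y) \<or>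
      (inj_on \<phi> (avoiding_shift F') \<and> \<phi> ` avoiding_shift F' = Y)"
    and "P3 \<equiv>
      (finite_to_one \<phi> (avoiding_shift F) Y \<and> \<phi> ` avoiding_shift F = Y) \<or>
      (finite_to_one \<phi> (avoiding_shift F') Y \<and> \<phi> ` avoiding_shift F' = Y)"
    and "P4 \<equiv> \<phi> ` avoiding_shift F = Y \<or> \<phi> ` avoiding_shift F' = Y"
  shows "(P1 \<longleftrightarrow> P2) \<and> (P1 \<longleftrightarrow> P3) \<and> (P1 \<longleftrightarrow> P4)"
proof -
  have Dne: "D \<noteq> []" using assms(1) by auto
  define V where "V = range (occurs_at D)"
  define N where "N = map Not D"
  define neg :: "point \<Rightarrow> point" where "neg = (\<lambda>x i. \<not> x i)"
  define sh :: "point \<Rightarrow> point" where "sh = (\<lambda>x j. x (j + - s))"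
  define sh' :: "point \<Rightarrow> point" where "sh' = (\<lambda>x j. x (j + s))"
  have \<phi>: "\<phi> = occurs_at D \<circ> sh"
    unfolding \<phi>_def using factor_code_eq[OF assms(2)] by (simp add: fun_eq_iff sh_def)
  have sh: "sh (sh' x) = x" "sh' (sh x) = x" for x by (simp_all add: sh_def sh'_def)
  have inj_sh: "inj_on sh B" for B by (rule inj_on_inverseI) (rule sh(2))
  have "range sh = UNIV" using sh(1) by (metis surjI)
  then have Y: "Y = V" unfolding Y_def \<phi> V_def image_comp[symmetric] by simp
  have V: "avoiding_shift F = V"
    unfolding F_def Y V_def by (rule avoiding_standard_forbidden_set[OF Dne])
  then have V': "avoiding_shift F' = neg ` V"
    unfolding F'_def avoiding_shift_map_Not neg_def by simp
  have "sh x \<in> V" "sh' x \<in> V" if "x \<in> V" for x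
    using range_occurs_at_shift that unfolding sh_def sh'_def V_def by blast+
  then have shV: "sh ` V = V" using sh(1) by (intro equalityI image_subsetI subsetI) (blast, metis image_eqI)
  have neg: "neg (neg x) = x" for x by (simp add: neg_def)
  have inj_neg: "inj_on neg B" for B by (rule inj_on_inverseI) (rule neg)
  have "sh ` neg ` V = neg ` sh ` V" by (simp add: image_image sh_def neg_def)
  then have shV': "sh ` neg ` V = neg ` V" using shV by simp
  have occ_neg: "occurs_at D \<circ> neg = occurs_at N"
    unfolding neg_def N_def by (rule ext) (simp add: occurs_at_Not)
  have VN: "V = range (occurs_at N)" unfolding V_def N_def by (simp add: range_occurs_at_map_Not)
  \<comment> \<open>The bijection \<open>sh\<close> preserves \<open>V\<close> and the set of
    complemented points of \<open>V\<close>, so it affects neither injectivity nor images.\<close>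
  have inj: "inj_on \<phi> V \<longleftrightarrow> inj_on (occurs_at D) V"
    unfolding \<phi> using comp_inj_on_iff[OF inj_sh[of V], of "occurs_at D"] by (simp add: shV)
  have onto: "\<phi> ` V = occurs_at D ` V" unfolding \<phi> image_comp[symmetric] shV ..
  \<comment> \<open>On complemented points \<open>D\<close> is read as \<open>N\<close>, and
    \<open>V\<close> is also the image belonging to \<open>N\<close>; the results for single blocks
    thus apply to \<open>N\<close>.\<close>
  have inj': "inj_on \<phi> (neg ` V) \<longleftrightarrow> inj_on (occurs_at N) V"
    unfolding \<phi> occ_neg[symmetric]
    using comp_inj_on_iff[OF inj_sh[of "neg ` V"], of "occurs_at D"]
      comp_inj_on_iff[OF inj_neg[of V], of "occurs_at D"] by (simp add: shV')
  have onto': "\<phi> ` neg ` V = occurs_at N ` V"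
    unfolding \<phi> image_comp[symmetric] shV' occ_neg[symmetric] ..
  have "P2" if P1
  proof -
    have "count_list N True = count_list D False" by (simp add: N_def count_list_map_Not)
    with that consider "count_list D True \<le> 1" | "count_list N True \<le> 1" by (auto simp: P1_def)
    then show ?thesis
    proof cases
      case 1
      from few_True_inj_onto[OF Dne 1] show ?thesis
        unfolding P2_def V V' Y inj onto by (simp add: V_def)
    next
      case 2
      have "N \<noteq> []" using Dne by (simp add: N_def)
      from few_True_inj_onto[OF this 2] show ?thesis
        unfolding P2_def V V' Y inj' onto' by (simp add: VN)
    qed
  qed
  moreover have P3 if P2
    using that unfolding P2_def P3_def by (auto intro: inj_on_finite_to_one)
  moreover have P4 if P3
    using that unfolding P3_def P4_def by blast
  moreover have P1 if P4
  proof (rule ccontr)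
    assume "\<not> P1"
    then have "2 \<le> count_list D True" "1 \<le> count_list D False"
        "2 \<le> count_list N True" "1 \<le> count_list N False"
      by (simp_all add: P1_def N_def count_list_map_Not)
    then have "occurs_at D ` V \<noteq> V" "occurs_at N ` V \<noteq> V"
      using two_True_not_onto[of D] two_True_not_onto[of N] by (simp_all add: V_def flip: VN)
    then show False using that unfolding P4_def V V' Y onto onto' by blast
  qed
  ultimately show ?thesis by blast
qed

end
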